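(* Let $G$ and $H$ be graphs. If $G$ and $H$ have the same acyclic polynomial, i.e. $A(G,x)=A(H,x)$, then $G$ and $H$ have the same order, the same girth and the same decycling number.
   Context: Graphs are finite, undirected and simple. The acyclic polynomial of a graph $G$ is $A(G,x)=\sum_{i\ge 0} a_i x^i$, where $a_i=|\{S\subseteq V(G): |S|=i \text{ and } G[S] \text{ is acyclic}\}|$ and $G[S]$ is the subgraph of $G$ induced by $S$ (acyclic means containing no cycle; the empty set is acyclic). The order of $G$ is $|V(G)|$. The girth is the length of a shortest cycle (infinite if $G$ is acyclic). The decycling number $\nabla(G)$ is the minimum size of a set $S\subseteq V(G)$ such that $G-S$ (the subgraph induced by $V(G)\setminus S$) is acyclic. *)

theory Defs
  imports
    "Graph_Theory.Graph_Theory"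
    "HOL-Computational_Algebra.Polynomial"
    "HOL-Library.Extended_Nat"
begin

text \<open>
  A finite simple undirected graph is the locale \<^locale>\<open>graph\<close>: a finite digraph with
  symmetric arc relation and neither loops nor parallel arcs, so that an edge $uv$ is the pair
  of arcs $(u,v)$, $(v,u)$.  For such digraphs \<^const>\<open>pre_digraph.cycle\<close> also admits
  $u,v,u$, i.e. an edge traversed back and forth, hence the length restriction below.
  For the same reason \<^const>\<open>forest\<close>, which forbids every directed cycle, is not the
  right notion of acyclicity here.
\<close>

definition undirected_cycle :: "('a, 'b) pre_digraph \<Rightarrow> 'b awalk \<Rightarrow> bool" where
  "undirected_cycle G p \<longleftrightarrow> pre_digraph.cycle G p \<and> 3 \<le> length p"

definition acyclic_graph :: "('a, 'b) pre_digraph \<Rightarrow> bool" where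
  "acyclic_graph G \<longleftrightarrow> \<not> (\<exists>p. undirected_cycle G p)"

definition num_acyclic_sets :: "('a, 'b) pre_digraph \<Rightarrow> nat \<Rightarrow> nat" where
  "num_acyclic_sets G i = card {S. S \<subseteq> verts G \<and> card S = i \<and> acyclic_graph (G \<restriction> S)}"

text \<open>The sum may stop at the order of the graph, since larger coefficients vanish.\<close>

definition acyclic_polynomial :: "('a, 'b) pre_digraph \<Rightarrow> int poly" where
  "acyclic_polynomial G = (\<Sum>i\<le>card (verts G). monom (int (num_acyclic_sets G i)) i)"

lemma coeff_acyclic_polynomial:
  assumes "finite (verts G)"
  shows "coeff (acyclic_polynomial G) i = int (num_acyclic_sets G i)"
proof (cases "i \<le> card (verts G)")
  case True
  then show ?thesis
    by (simp add: acyclic_polynomial_def coeff_sum)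
next
  case False
  then have empty: "{S. S \<subseteq> verts G \<and> card S = i \<and> acyclic_graph (G \<restriction> S)} = {}"
    using assms card_mono by blast
  show ?thesis
    unfolding acyclic_polynomial_def num_acyclic_sets_def[of G i] empty
    using False by (simp add: coeff_sum)
qed

definition graph_order :: "('a, 'b) pre_digraph \<Rightarrow> nat" where
  "graph_order G = card (verts G)"

text \<open>The infimum of the empty set in \<^typ>\<open>enat\<close> is \<open>\<infinity>\<close>.\<close>

definition girth :: "('a, 'b) pre_digraph \<Rightarrow> enat" where
  "girth G = (INF p \<in> {p. undirected_cycle G p}. enat (length p))"

definition decycling_number :: "('a, 'b) pre_digraph \<Rightarrow> nat" where
  "decycling_number G =
     (LEAST k. \<exists>S \<subseteq> verts G. card S = k \<and> acyclic_graph (G \<restriction> (verts G - S)))"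

end

theory Submission
  imports Defs
begin

text \<open>
  Each of the three parameters can be read off from the numbers \<open>a\<^sub>i\<close> of acyclic
  \<open>i\<close>-sets, which are the coefficients of the polynomial.

  \<^item> A cycle needs at least three vertices, so every singleton is acyclic and \<open>a\<^sub>1\<close> is the order
    \<open>n\<close>.
  \<^item> The vertices of a cycle of length \<open>i\<close> form an \<open>i\<close>-set that is not acyclic, whence
    \<open>a\<^sub>i < n choose i\<close>.  Conversely, \<open>a\<^sub>i < n choose i\<close> yields an \<open>i\<close>-set that is not acyclic,
    hence a cycle of length at most \<open>i\<close>.  So the girth is the least \<open>i\<close> with
    \<open>a\<^sub>i \<noteq> n choose i\<close>.
  \<^item> Taking complements, a decycling set of size \<open>k\<close> is the same as an acyclic set of size
    \<open>n - k\<close>, so the decycling number is the least \<open>k \<le> n\<close> with \<open>a\<^bsub>n-k\<^esub> \<noteq> 0\<close>.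

  The graph-theoretic input is that a cycle has as many vertices as arcs, and that the cycles of
  an induced subgraph are the cycles of the graph that stay inside the inducing set.
\<close>

lemma (in wf_digraph) closed_awalk_verts_eq_heads:
  assumes "awalk u p u" and "p \<noteq> []"
  shows "set (awalk_verts u p) = head G ` set p"
proof -
  have cas: "cas u p u"
    using assms(1) by (simp add: awalk_def)
  have "head G (last p) = u"
    using awlast_if_cas[OF cas] assms(2) by (simp add: awalk_verts_conv)
  then have "u \<in> head G ` set p"
    using assms(2) by force
  then show ?thesis
    using cas assms(2) by (auto simp: awalk_verts_conv' cas_simp)
qed

text \<open>
  The initial vertex of a cycle is visited twice; dropping its first occurrence leaves the list
  of heads, so the heads of the arcs are the vertices of the cycle, each occurring once.
\<close>

lemma (in wf_digraph) cycle_heads: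
  assumes "cycle p"
  shows "head G ` set p \<subseteq> verts G" and "card (head G ` set p) = length p"
proof -
  from assms obtain u where u: "awalk u p u" "distinct (tl (awalk_verts u p))" "p \<noteq> []"
    unfolding cycle_def by blast
  then have "tl (awalk_verts u p) = map (head G) p"
    by (auto simp: awalk_def awalk_verts_conv')
  with u have "distinct (map (head G) p)"
    by simp
  then show "card (head G ` set p) = length p"
    by (metis distinct_card length_map set_map)
  show "head G ` set p \<subseteq> verts G"
    using u by (auto simp: awalk_def)
qed

lemma (in wf_digraph) undirected_cycle_induce_iff:
  assumes "S \<subseteq> verts G"
  shows "undirected_cycle (G \<restriction> S) p \<longleftrightarrow> undirected_cycle G p \<and> head G ` set p \<subseteq> S"
proof
  assume p: "undirected_cycle (G \<restriction> S) p"
  interpret GS: wf_digraph "G \<restriction> S"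
    by (rule wellformed_induce_subgraph)
  have "cycle p"
    using p subgraph_cycle[OF subgraph_induce_subgraphI[OF assms]]
    by (simp add: undirected_cycle_def)
  with p show "undirected_cycle G p \<and> head G ` set p \<subseteq> S"
    using GS.cycle_heads(1)[of p] by (simp add: undirected_cycle_def)
next
  assume p: "undirected_cycle G p \<and> head G ` set p \<subseteq> S"
  then obtain u where u: "awalk u p u" "distinct (tl (awalk_verts u p))" "p \<noteq> []"
    by (auto simp: undirected_cycle_def cycle_def)
  have "set (awalk_verts u p) \<subseteq> S"
    using p closed_awalk_verts_eq_heads[OF u(1,3)] by simp
  then have "pre_digraph.awalk (G \<restriction> S) u p u"
    using u by (auto intro: awalk_induce)
  moreover have "pre_digraph.awalk_verts (G \<restriction> S) u p = awalk_verts u p"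
    by (simp add: awalk_verts_induce)
  ultimately show "undirected_cycle (G \<restriction> S) p"
    using p u by (auto simp: undirected_cycle_def pre_digraph.cycle_def)
qed

lemma (in wf_digraph) acyclic_induce_iff:
  assumes "S \<subseteq> verts G"
  shows "acyclic_graph (G \<restriction> S) \<longleftrightarrow> (\<nexists>p. undirected_cycle G p \<and> head G ` set p \<subseteq> S)"
  using undirected_cycle_induce_iff[OF assms] by (simp add: acyclic_graph_def)

lemma (in fin_digraph) num_acyclic_sets_1: "num_acyclic_sets G 1 = card (verts G)"
proof -
  have "acyclic_graph (G \<restriction> {v})" if "v \<in> verts G" for v
  proof -
    have False if p: "undirected_cycle G p" "head G ` set p \<subseteq> {v}" for p
    proof -
      have "length p \<le> card {v}"
        using cycle_heads(2)[of p] p card_mono[OF _ p(2)] by (simp add: undirected_cycle_def)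
      with p(1) show False
        by (simp add: undirected_cycle_def)
    qed
    with that show ?thesis
      by (auto simp: acyclic_induce_iff)
  qed
  then have "{S. S \<subseteq> verts G \<and> card S = 1 \<and> acyclic_graph (G \<restriction> S)} = (\<lambda>v. {v}) ` verts G"
    by (auto simp: card_1_singleton_iff)
  then show ?thesis
    by (simp add: num_acyclic_sets_def card_image)
qed

lemma (in fin_digraph) num_acyclic_sets_eq_binomial_iff:
  "num_acyclic_sets G i = card (verts G) choose i \<longleftrightarrow>
    (\<forall>S. S \<subseteq> verts G \<and> card S = i \<longrightarrow> acyclic_graph (G \<restriction> S))"
    (is "_ \<longleftrightarrow> ?all")
proof -
  let ?A = "{S. S \<subseteq> verts G \<and> card S = i \<and> acyclic_graph (G \<restriction> S)}"
  let ?B = "{S. S \<subseteq> verts G \<and> card S = i}"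
  have "finite ?B"
    by (rule finite_subset[of _ "Pow (verts G)"]) auto
  then have "card ?A = card ?B \<longleftrightarrow> ?A = ?B"
    by (metis (no_types, lifting) card_subset_eq mem_Collect_eq subsetI)
  also have "\<dots> \<longleftrightarrow> ?all"
    by blast
  finally show ?thesis
    by (simp add: num_acyclic_sets_def n_subsets)
qed

text \<open>
  The set on the right contains every cycle length, and in general more numbers, since a set
  that is not acyclic may have more vertices than its shortest cycle.  Each of its members lies
  above a cycle length, however, so the two infima agree.  This includes the case without
  cycles, where both sets are empty.
\<close>

lemma (in fin_digraph) girth_eq_INF_num_acyclic_sets:
  "girth G = (INF i \<in> {i. num_acyclic_sets G i \<noteq> card (verts G) choose i}. enat i)"
    (is "_ = (INF i \<in> ?I. enat i)")
  unfolding girth_def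
proof (rule antisym)
  show "(INF p \<in> {p. undirected_cycle G p}. enat (length p)) \<le> (INF i \<in> ?I. enat i)"
  proof (rule INF_mono)
    fix i assume "i \<in> ?I"
    then obtain S where S: "S \<subseteq> verts G" "card S = i" "\<not> acyclic_graph (G \<restriction> S)"
      by (auto simp: num_acyclic_sets_eq_binomial_iff)
    then obtain p where p: "undirected_cycle G p" "head G ` set p \<subseteq> S"
      by (auto simp: acyclic_induce_iff)
    have "finite S"
      using S(1) finite_verts by (rule finite_subset)
    then have "length p \<le> i"
      using card_mono[OF _ p(2)] cycle_heads(2)[of p] p(1) S(2) by (simp add: undirected_cycle_def)
    with p(1) show "\<exists>p \<in> {p. undirected_cycle G p}. enat (length p) \<le> enat i"
      by auto
  qed
  show "(INF i \<in> ?I. enat i) \<le> (INF p \<in> {p. undirected_cycle G p}. enat (length p))"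
  proof (rule INF_mono)
    fix p assume "p \<in> {p. undirected_cycle G p}"
    then have p: "undirected_cycle G p" and "cycle p"
      by (auto simp: undirected_cycle_def)
    note heads = cycle_heads[OF \<open>cycle p\<close>]
    have "\<not> acyclic_graph (G \<restriction> (head G ` set p))"
      using p by (auto simp: acyclic_induce_iff[OF heads(1)])
    then have "length p \<in> ?I"
      using heads by (auto simp: num_acyclic_sets_eq_binomial_iff)
    then show "\<exists>i \<in> ?I. enat i \<le> enat (length p)"
      by blast
  qed
qed

lemma (in fin_digraph) num_acyclic_sets_neq_0_iff:
  "num_acyclic_sets G i \<noteq> 0 \<longleftrightarrow> (\<exists>S \<subseteq> verts G. card S = i \<and> acyclic_graph (G \<restriction> S))"
proof -
  have "finite {S. S \<subseteq> verts G \<and> card S = i \<and> acyclic_graph (G \<restriction> S)}"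
    by (rule finite_subset[of _ "Pow (verts G)"]) auto
  then show ?thesis
    by (auto simp: num_acyclic_sets_def)
qed

lemma (in fin_digraph) decycling_set_iff_num_acyclic_sets:
  "(\<exists>S \<subseteq> verts G. card S = k \<and> acyclic_graph (G \<restriction> (verts G - S))) \<longleftrightarrow>
    k \<le> card (verts G) \<and> num_acyclic_sets G (card (verts G) - k) \<noteq> 0"
proof
  assume "\<exists>S \<subseteq> verts G. card S = k \<and> acyclic_graph (G \<restriction> (verts G - S))"
  then obtain S where S: "S \<subseteq> verts G" "card S = k" "acyclic_graph (G \<restriction> (verts G - S))"
    by blast
  then have "k \<le> card (verts G)"
    using card_mono[OF finite_verts] by blast
  moreover have "card (verts G - S) = card (verts G) - k"
    using S by (meson card_Diff_subset finite_subset finite_verts)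
  ultimately show "k \<le> card (verts G) \<and> num_acyclic_sets G (card (verts G) - k) \<noteq> 0"
    using S(3) unfolding num_acyclic_sets_neq_0_iff by blast
next
  assume k: "k \<le> card (verts G) \<and> num_acyclic_sets G (card (verts G) - k) \<noteq> 0"
  then obtain T where T: "T \<subseteq> verts G" "card T = card (verts G) - k" "acyclic_graph (G \<restriction> T)"
    unfolding num_acyclic_sets_neq_0_iff by blast
  have "card (verts G - T) = k"
    using T k by (metis card_Diff_subset diff_diff_cancel finite_subset finite_verts)
  moreover have "verts G - (verts G - T) = T"
    using T(1) by blast
  ultimately show "\<exists>S \<subseteq> verts G. card S = k \<and> acyclic_graph (G \<restriction> (verts G - S))"
    using T(3) by (intro exI[of _ "verts G - T"]) simp
qed

lemma (in fin_digraph) decycling_number_eq_LEAST_num_acyclic_sets: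
  "decycling_number G =
    (LEAST k. k \<le> card (verts G) \<and> num_acyclic_sets G (card (verts G) - k) \<noteq> 0)"
  unfolding decycling_number_def decycling_set_iff_num_acyclic_sets ..

theorem theorem1p1:
  fixes G :: "('a, 'b) pre_digraph" and H :: "('c, 'd) pre_digraph"
  assumes "graph G" and "graph H"
    and "acyclic_polynomial G = acyclic_polynomial H"
  shows "graph_order G = graph_order H \<and> girth G = girth H \<and>
    decycling_number G = decycling_number H"
proof -
  interpret G: graph G by fact
  interpret H: graph H by fact
  have coeffs: "num_acyclic_sets G = num_acyclic_sets H"
  proof
    fix i
    have "int (num_acyclic_sets G i) = int (num_acyclic_sets H i)"
      using assms(3) coeff_acyclic_polynomial[OF G.finite_verts]
        coeff_acyclic_polynomial[OF H.finite_verts] by metis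
    then show "num_acyclic_sets G i = num_acyclic_sets H i"
      by simp
  qed
  have order: "card (verts G) = card (verts H)"
    using G.num_acyclic_sets_1 H.num_acyclic_sets_1 coeffs by simp
  then show ?thesis
    using coeffs by (simp add: graph_order_def G.girth_eq_INF_num_acyclic_sets
        H.girth_eq_INF_num_acyclic_sets G.decycling_number_eq_LEAST_num_acyclic_sets
        H.decycling_number_eq_LEAST_num_acyclic_sets)
qed

end
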